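(* $\min\{\mathfrak{b},\mathrm{non}(\mathcal{E}^* )\}\leq\mathrm{non}(\langle\mathcal{E},\mathcal{M}\rangle)\leq\mathrm{non}(\mathcal{E}^* )$.
   Context: $2^\omega$ is the Cantor space with coordinatewise addition modulo 2; $\mathcal{M}$ is the $\sigma$-ideal of meager subsets of $2^\omega$ and $\mathcal{E}$ is the $\sigma$-ideal on $2^\omega$ generated by closed Lebesgue measure zero sets. $X+E=\{x+e:x\in X,e\in E\}$. $\langle\mathcal{E},\mathcal{M}\rangle=\{X\subseteq2^\omega:\forall E\in\mathcal{E}\ X+E\in\mathcal{M}\}$ and $\mathcal{E}^*=\{X\subseteq 2^\omega:\forall E\in\mathcal{E}\ X+E\neq 2^\omega\}$. For a class $\mathcal{X}$ of subsets of $2^\omega$, $\mathrm{non}(\mathcal{X})=\min\{|Y|:Y\subseteq2^\omega,\ Y\notin\mathcal{X}\}$. $\mathfrak{b}$ is the bounding number (least size of an unbounded family in $(\omega^\omega,\leq^* )$). *)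

theory Defs
  imports "HOL-Probability.Probability"
begin

unbundle cardinal_syntax

section \<open>Cardinal arithmetic\<close>

text \<open>
  Cardinals are represented, as in the library, by minimal well-orders up to \<open>=o\<close>.
  \<open>least_card \<A>\<close> is the least cardinality of a member of \<open>\<A>\<close>; it is meaningful
  only for nonempty \<open>\<A>\<close>.
\<close>

definition least_card :: "'a set set \<Rightarrow> 'a rel" where
  "least_card \<A> = |SOME A. A \<in> \<A> \<and> (\<forall>B\<in>\<A>. |A| \<le>o |B| )|"

lemma least_card_attained:
  assumes "\<A> \<noteq> {}"
  shows "\<exists>A\<in>\<A>. least_card \<A> = |A| \<and> (\<forall>B\<in>\<A>. |A| \<le>o |B| )"
proof -
  have "\<exists>r\<in>card_of ` \<A>. \<forall>r'\<in>card_of ` \<A>. r \<le>o r'"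
    using assms by (intro exists_minim_Card_order) (auto simp: card_of_Card_order)
  then have "\<exists>A. A \<in> \<A> \<and> (\<forall>B\<in>\<A>. |A| \<le>o |B| )"
    by blast
  from someI_ex[OF this] show ?thesis
    unfolding least_card_def by blast
qed

lemma least_card_le: "B \<in> \<A> \<Longrightarrow> least_card \<A> \<le>o |B|"
  using least_card_attained[of \<A>] by (metis empty_iff)

text \<open>
  The minimum of two cardinals. They may live on different types, so the smaller one is
  copied into the sum type.
\<close>

definition card_min :: "'a rel \<Rightarrow> 'b rel \<Rightarrow> ('a + 'b) rel" where
  "card_min r s = (if r \<le>o s then |Inl ` Field r| else |Inr ` Field s| )"

lemma card_min_eq_left:
  assumes "Card_order r" "r \<le>o s"
  shows "card_min r s =o r"
proof -
  have "|Inl ` Field r| =o |Field r|"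
    by (meson card_of_ordIso inj_Inl inj_on_imp_bij_betw inj_on_subset ordIso_symmetric subset_UNIV)
  also have "|Field r| =o r"
    by (rule card_of_Field_ordIso[OF assms(1)])
  finally show ?thesis
    using assms(2) by (simp add: card_min_def)
qed

lemma card_min_eq_right:
  assumes "Card_order r" "Card_order s" "s \<le>o r"
  shows "card_min r s =o s"
proof (cases "r \<le>o s")
  case True
  then show ?thesis
    using assms card_min_eq_left[OF assms(1) True] by (meson ordIso_iff_ordLeq ordIso_transitive)
next
  case False
  have "|Inr ` Field s| =o |Field s|"
    by (meson card_of_ordIso inj_Inr inj_on_imp_bij_betw inj_on_subset ordIso_symmetric subset_UNIV)
  also have "|Field s| =o s"
    by (rule card_of_Field_ordIso[OF assms(2)])
  finally show ?thesis
    using False by (simp add: card_min_def)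
qed

section \<open>The Cantor space\<close>

text \<open>
  The topology on \<^typ>\<open>nat \<Rightarrow> bool\<close> is the product topology of the library, with
  \<^typ>\<open>bool\<close> discrete.
\<close>

type_synonym cantor = "nat \<Rightarrow> bool"

text \<open>Identifying \<open>False\<close> with 0 and \<open>True\<close> with 1, addition modulo 2 is exclusive or.\<close>

definition cantor_add :: "cantor \<Rightarrow> cantor \<Rightarrow> cantor" where
  "cantor_add x y = (\<lambda>n. x n \<noteq> y n)"

definition sumset :: "cantor set \<Rightarrow> cantor set \<Rightarrow> cantor set" where
  "sumset X E = {cantor_add x e |x e. x \<in> X \<and> e \<in> E}"

instance bool :: second_countable_topology
proof
  have "open A = generate_topology UNIV A" for A :: "bool set"
    using Topological_Spaces.open_discrete[of A] generate_topology.Basis[of A UNIV] by simp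
  then have "open = generate_topology (UNIV :: bool set set)"
    by (rule ext)
  moreover have "countable (UNIV :: bool set set)"
    by simp
  ultimately show "\<exists>B :: bool set set. countable B \<and> open = generate_topology B"
    by blast
qed

text \<open>Lebesgue measure on the Cantor space: the product of the uniform measures on \<open>{0, 1}\<close>.\<close>

definition cantor_measure :: "cantor measure" where
  "cantor_measure = (\<Pi>\<^sub>M n\<in>(UNIV :: nat set). uniform_count_measure (UNIV :: bool set))"

lemma sets_cantor_measure: "sets cantor_measure = sets borel"
proof -
  have "sets cantor_measure = sets (\<Pi>\<^sub>M n\<in>(UNIV :: nat set). (borel :: bool measure))"
    unfolding cantor_measure_def
    by (rule sets_PiM_cong) (simp_all add: sets_uniform_count_measure sets_borel_eq_count_space)
  also have "... = sets borel"
    by (rule sets_PiM_equal_borel)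
  finally show ?thesis .
qed

lemma prob_space_cantor_measure: "prob_space cantor_measure"
  unfolding cantor_measure_def
  by (intro prob_space_PiM prob_space_uniform_count_measure) simp_all

section \<open>The ideals and the cardinal invariants\<close>

definition nowhere_dense :: "'a::topological_space set \<Rightarrow> bool" where
  "nowhere_dense A \<longleftrightarrow> interior (closure A) = {}"

definition meager :: "'a::topological_space set \<Rightarrow> bool" where
  "meager X \<longleftrightarrow> (\<exists>A :: nat \<Rightarrow> 'a set. (\<forall>n. nowhere_dense (A n)) \<and> X = (\<Union>n. A n))"

inductive_set generated_sigma_ideal :: "'a set set \<Rightarrow> 'a set set" for \<G> :: "'a set set" where
  base: "G \<in> \<G> \<Longrightarrow> G \<in> generated_sigma_ideal \<G>"
| empty: "{} \<in> generated_sigma_ideal \<G>"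
| subset: "A \<in> generated_sigma_ideal \<G> \<Longrightarrow> B \<subseteq> A \<Longrightarrow> B \<in> generated_sigma_ideal \<G>"
| Union: "(\<And>n::nat. A n \<in> generated_sigma_ideal \<G>) \<Longrightarrow> (\<Union>n. A n) \<in> generated_sigma_ideal \<G>"

definition ideal_M :: "cantor set set" where
  "ideal_M = {X. meager X}"

definition ideal_E :: "cantor set set" where
  "ideal_E = generated_sigma_ideal {C. closed C \<and> C \<in> null_sets cantor_measure}"

definition E_into_M :: "cantor set set" where
  "E_into_M = {X. \<forall>E\<in>ideal_E. sumset X E \<in> ideal_M}"

definition E_star :: "cantor set set" where
  "E_star = {X. \<forall>E\<in>ideal_E. sumset X E \<noteq> UNIV}"

definition non :: "cantor set set \<Rightarrow> cantor rel" where
  "non \<X> = least_card {Y. Y \<notin> \<X>}"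

definition le_star :: "(nat \<Rightarrow> nat) \<Rightarrow> (nat \<Rightarrow> nat) \<Rightarrow> bool" where
  "le_star f g \<longleftrightarrow> (\<forall>\<^sub>F n in sequentially. f n \<le> g n)"

definition bounding_number :: "(nat \<Rightarrow> nat) rel" where
  "bounding_number = least_card {F. \<not> (\<exists>g. \<forall>f\<in>F. le_star f g)}"

end

theory Submission
  imports Defs
begin

text \<open>
  The upper bound is the Baire category theorem: the whole space is not meager.

  For the lower bound, let \<open>E\<close> be covered by closed null sets \<open>C n\<close>, increasing in \<open>n\<close>, and let \<open>X\<close>
  be smaller than both the bounding number and \<open>non(E*)\<close>. Closing \<open>\<Union>n. C n\<close> under translation by the
  countable dense group \<open>Q\<close> of finitely supported points stays inside the ideal, so some \<open>z\<close> has
  \<open>z + Q\<close> disjoint from \<open>X + E\<close>. For \<open>x \<in> X\<close> and each pair \<open>(n, q)\<close>, the basic neighbourhood of \<open>z + q\<close>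
  of some depth \<open>f x (n, q)\<close> misses \<open>x + C n\<close>. Let \<open>g\<close> dominate all \<open>f x\<close>, and let \<open>U n\<close> be the dense open
  union over \<open>q\<close> of the neighbourhoods of \<open>z + q\<close> of depth \<open>g (n, q)\<close>. For all \<open>x \<in> X\<close> and \<open>j\<close>, the set
  \<open>x + C j\<close> misses \<open>U n\<close> for almost all \<open>n\<close>, so the complements of the \<open>U n\<close> cover \<open>X + E\<close>.
\<close>

section \<open>Translations and cylinders\<close>

lemma cantor_add_cancel [simp]: "cantor_add x (cantor_add x y) = y"
  by (auto simp: cantor_add_def)

lemma cantor_add_assoc: "cantor_add (cantor_add x y) z = cantor_add x (cantor_add y z)"
  by (auto simp: cantor_add_def)

lemma cantor_add_commute: "cantor_add x y = cantor_add y x"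
  by (auto simp: cantor_add_def)

text \<open>Every translation is an involution. Closedness and nullity of translates thus reduce to
  continuity and measurability.\<close>

lemma cantor_add_image_eq_vimage: "cantor_add x ` A = cantor_add x -` A"
  by (auto simp: image_iff) (metis cantor_add_cancel)

lemma continuous_on_cantor_add: "continuous_on UNIV (cantor_add x)"
proof -
  have "continuous_on UNIV (\<lambda>y. cantor_add x y n)" for n
    unfolding cantor_add_def
    by (rule continuous_on_compose2[of UNIV "\<lambda>b. x n \<noteq> b"]) auto
  then show ?thesis
    by (rule continuous_on_coordinatewise_then_product)
qed

lemma closed_translation:
  assumes "closed C"
  shows "closed (cantor_add x ` C)"
  using assms continuous_on_cantor_add
  by (simp add: cantor_add_image_eq_vimage closed_vimage)

definition cylinder :: "nat \<Rightarrow> cantor \<Rightarrow> cantor set" where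
  "cylinder k x = {y. \<forall>i<k. y i = x i}"

lemma center_in_cylinder [simp]: "x \<in> cylinder k x"
  by (simp add: cylinder_def)

lemma cylinder_antimono: "k \<le> l \<Longrightarrow> cylinder l x \<subseteq> cylinder k x"
  by (auto simp: cylinder_def)

lemma cylinder_eq_Inter: "cylinder k x = (\<Inter>i\<in>{..<k}. (\<lambda>y. y i) -` {x i})"
  by (auto simp: cylinder_def)

lemma open_cylinder: "open (cylinder k x)"
  unfolding cylinder_eq_Inter
  by (intro open_INT finite_lessThan ballI open_vimage continuous_on_product_coordinates
      Topological_Spaces.open_discrete)

lemma closed_cylinder: "closed (cylinder k x)"
  unfolding cylinder_eq_Inter
  by (intro closed_INT ballI closed_vimage continuous_on_product_coordinates closed_singleton)

text \<open>A basic open box restricts only finitely many coordinates; any bound on these serves as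
  \<open>k\<close>.\<close>

lemma open_contains_cylinder:
  assumes "open U" "x \<in> U"
  obtains k where "cylinder k x \<subseteq> U"
proof -
  have "openin (product_topology (\<lambda>i. euclidean) UNIV) U"
    using assms(1) by (simp add: open_fun_def)
  from product_topology_open_contains_basis[OF this assms(2)]
  obtain V where V: "x \<in> (\<Pi>\<^sub>E i\<in>UNIV. V i)" "finite {i. V i \<noteq> UNIV}" "(\<Pi>\<^sub>E i\<in>UNIV. V i) \<subseteq> U"
    by auto
  obtain k where k: "\<And>i. V i \<noteq> UNIV \<Longrightarrow> i < k"
    using V(2) by (auto simp: finite_nat_set_iff_bounded)
  have "y i \<in> V i" if "y \<in> cylinder k x" for y i
    using that k[of i] V(1) by (cases "i < k") (auto simp: cylinder_def PiE_iff)
  then have "cylinder k x \<subseteq> U"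
    using V(3) by (auto simp: PiE_iff)
  then show ?thesis by (rule that)
qed

lemma cylinder_translation: "y \<in> cylinder k x \<Longrightarrow> cantor_add z y \<in> cylinder k (cantor_add z x)"
  by (auto simp: cylinder_def cantor_add_def)

text \<open>The binary digits of \<open>q\<close> enumerate, by the naturals, the countable group of
  finitely supported points.\<close>

definition finite_point :: "nat \<Rightarrow> cantor" where
  "finite_point q = (\<lambda>n. n \<in> set_decode q)"

lemma finite_point_dense: "\<exists>q. finite_point q \<in> cylinder k x"
proof
  \<comment> \<open>The first \<open>k\<close> coordinates of \<open>x\<close>, continued by
    zeros.\<close>
  show "finite_point (set_encode {i. i < k \<and> x i}) \<in> cylinder k x"
    by (auto simp: finite_point_def cylinder_def)
qed

section \<open>The measure on the Cantor space\<close>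

interpretation coin: product_prob_space "\<lambda>_::nat. uniform_count_measure (UNIV :: bool set)" UNIV
  by (rule product_prob_spaceI) (simp add: prob_space_uniform_count_measure)

lemma emeasure_cylinder: "emeasure cantor_measure (cylinder k x) = ennreal ((1/2) ^ k)"
proof -
  let ?M = "\<lambda>_::nat. uniform_count_measure (UNIV :: bool set)"
  have "cylinder k x = prod_emb UNIV ?M {..<k} (\<Pi>\<^sub>E j\<in>{..<k}. {x j})"
    by (rule set_eqI)
       (simp add: cylinder_def prod_emb_iff PiE_iff space_uniform_count_measure Ball_def)
  also have "emeasure cantor_measure \<dots> = (\<Prod>j<k. emeasure (?M j) {x j})"
    unfolding cantor_measure_def
    by (intro coin.emeasure_PiM_emb) (auto simp: sets_uniform_count_measure)
  also have "\<dots> = (\<Prod>j<k. ennreal (1/2))"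
    by (intro prod.cong refl, subst emeasure_uniform_count_measure) auto
  also have "\<dots> = ennreal ((1/2) ^ k)"
    unfolding prod_constant card_lessThan by (rule ennreal_power) simp
  finally show ?thesis .
qed

lemma singleton_eq_Inter_cylinder: "{x} = (\<Inter>k. cylinder k x)"
  by (auto simp: cylinder_def)

lemma closed_singleton_cantor: "closed {x :: cantor}"
  unfolding singleton_eq_Inter_cylinder by (intro closed_INT ballI closed_cylinder)

lemma singleton_null_cantor: "{x} \<in> null_sets cantor_measure"
proof
  show "{x} \<in> sets cantor_measure"
    by (simp add: sets_cantor_measure borel_closed closed_singleton_cantor)
  have "emeasure cantor_measure {x} \<le> ennreal ((1/2) ^ k)" for k
    unfolding emeasure_cylinder[of k x, symmetric]
    by (rule emeasure_mono) (auto simp: sets_cantor_measure borel_open open_cylinder)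
  moreover have "(\<lambda>k. ennreal ((1/2) ^ k)) \<longlonglongrightarrow> ennreal 0"
    by (intro tendsto_ennrealI LIMSEQ_power_zero) simp
  ultimately show "emeasure cantor_measure {x} = 0"
    using LIMSEQ_le_const[of "\<lambda>k. ennreal ((1/2) ^ k)" 0] by auto
qed

lemma measurable_cantor_add: "cantor_add x \<in> measurable cantor_measure cantor_measure"
  using borel_measurable_continuous_onI[OF continuous_on_cantor_add]
  by (simp add: measurable_cong_sets[OF sets_cantor_measure sets_cantor_measure])

text \<open>A product measure is determined by its values on finite boxes. Translation fixes or
  flips each coordinate, so it preserves the cardinality, hence the uniform measure, of each
  side.\<close>

lemma distr_cantor_add: "distr cantor_measure cantor_measure (cantor_add x) = cantor_measure"
proof -
  let ?M = "\<lambda>_::nat. uniform_count_measure (UNIV :: bool set)"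
  have "distr cantor_measure cantor_measure (cantor_add x) = PiM UNIV ?M"
  proof (rule coin.PiM_eq)
    show "sets (distr cantor_measure cantor_measure (cantor_add x)) = sets (PiM UNIV ?M)"
      by (simp add: cantor_measure_def)
  next
    fix J :: "nat set" and F :: "nat \<Rightarrow> bool set"
    assume J: "finite J"
    define G where "G j = (\<lambda>b. x j \<noteq> b) ` F j" for j
    have G_iff: "b \<in> G j \<longleftrightarrow> (x j \<noteq> b) \<in> F j" for b j
      by (cases "x j"; cases b) (auto simp: G_def image_iff)
    have card: "card (G j) = card (F j)" for j
      unfolding G_def by (rule card_image) (auto simp: inj_on_def)
    have "prod_emb UNIV ?M J (\<Pi>\<^sub>E j\<in>J. F j) \<in> sets cantor_measure"
      unfolding cantor_measure_def using J by (auto intro!: sets_PiM_I simp: sets_uniform_count_measure)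
    then have "emeasure (distr cantor_measure cantor_measure (cantor_add x)) (prod_emb UNIV ?M J (\<Pi>\<^sub>E j\<in>J. F j))
        = emeasure cantor_measure (cantor_add x -` prod_emb UNIV ?M J (\<Pi>\<^sub>E j\<in>J. F j) \<inter> space cantor_measure)"
      by (rule emeasure_distr[OF measurable_cantor_add])
    also have "cantor_add x -` prod_emb UNIV ?M J (\<Pi>\<^sub>E j\<in>J. F j) \<inter> space cantor_measure
        = prod_emb UNIV ?M J (\<Pi>\<^sub>E j\<in>J. G j)"
      by (auto simp: prod_emb_def cantor_measure_def space_PiM space_uniform_count_measure
          PiE_iff G_iff cantor_add_def)
    also have "emeasure cantor_measure \<dots> = (\<Prod>j\<in>J. emeasure (?M j) (G j))"
      unfolding cantor_measure_def using J
      by (intro coin.emeasure_PiM_emb) (auto simp: sets_uniform_count_measure)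
    also have "\<dots> = (\<Prod>j\<in>J. emeasure (?M j) (F j))"
      by (simp add: emeasure_uniform_count_measure card)
    finally show "emeasure (distr cantor_measure cantor_measure (cantor_add x)) (prod_emb UNIV ?M J (\<Pi>\<^sub>E j\<in>J. F j))
        = (\<Prod>j\<in>J. emeasure (?M j) (F j))" .
  qed
  then show ?thesis by (simp add: cantor_measure_def)
qed

lemma null_sets_translation:
  assumes "C \<in> null_sets cantor_measure"
  shows "cantor_add x ` C \<in> null_sets cantor_measure"
proof -
  have space: "space cantor_measure = UNIV"
    using sets_eq_imp_space_eq[OF sets_cantor_measure] by simp
  have "C \<in> null_sets (distr cantor_measure cantor_measure (cantor_add x))"
    using assms by (simp add: distr_cantor_add)
  then show ?thesis
    using measurable_cantor_add by (simp add: null_sets_distr_iff space cantor_add_image_eq_vimage)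
qed

section \<open>Meager sets and the ideal generated by closed null sets\<close>

lemma meager_subset:
  fixes A B :: "'a::topological_space set"
  assumes "meager A" "B \<subseteq> A"
  shows "meager B"
proof -
  obtain N :: "nat \<Rightarrow> 'a set" where N: "\<And>n. nowhere_dense (N n)" "A = (\<Union>n. N n)"
    using assms(1) unfolding meager_def by blast
  have "nowhere_dense (N n \<inter> B)" for n
    using N(1)[of n] interior_mono[OF closure_mono[of "N n \<inter> B" "N n"]]
    unfolding nowhere_dense_def by auto
  moreover have "B = (\<Union>n. N n \<inter> B)"
    using N(2) assms(2) by auto
  ultimately show ?thesis
    unfolding meager_def by (intro exI[of _ "\<lambda>n. N n \<inter> B"]) simp
qed

text \<open>Baire category theorem: a product of finite discrete spaces is compact Hausdorff, hence
  locally compact and regular.\<close>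

lemma not_meager_UNIV: "\<not> meager (UNIV :: cantor set)"
proof
  assume "meager (UNIV :: cantor set)"
  then obtain A :: "nat \<Rightarrow> cantor set" where A: "\<And>n. nowhere_dense (A n)" "UNIV = (\<Union>n. A n)"
    unfolding meager_def by metis
  have compact_bool: "compact_space (euclidean :: bool topology)"
    by (simp add: compact_space_def compactin_euclidean_iff finite_imp_compact)
  have compact: "compact_space (euclidean :: cantor topology)"
    using compact_bool compact_space_product_topology[of "\<lambda>_. euclidean :: bool topology" "UNIV :: nat set"]
    unfolding euclidean_product_topology by blast
  have "Hausdorff_space (euclidean :: bool topology)"
    unfolding Hausdorff_space_def
    by (intro allI impI, rule_tac x = "{x}" in exI, rule_tac x = "{y}" in exI)
       (auto simp: Topological_Spaces.open_discrete)
  then have Hausdorff: "Hausdorff_space (euclidean :: cantor topology)"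
    using Hausdorff_space_product_topology[of "\<lambda>_. euclidean :: bool topology" "UNIV :: nat set"]
    unfolding euclidean_product_topology by blast
  have "(euclidean :: cantor topology) interior_of \<Union>(range (\<lambda>n. closure (A n))) = {}"
  proof (rule Baire_category_alt)
    show "completely_metrizable_space (euclidean :: cantor topology) \<or>
        locally_compact_space (euclidean :: cantor topology) \<and> regular_space (euclidean :: cantor topology)"
      using compact Hausdorff
      by (auto simp: compact_imp_locally_compact_space intro: compact_Hausdorff_imp_regular_space)
  qed (use A(1) in \<open>auto simp: nowhere_dense_def\<close>)
  moreover have "\<Union>(range (\<lambda>n. closure (A n))) = UNIV"
    using A(2) closure_subset by blast
  ultimately show False by simp
qed

text \<open>Rule induction: subsets inherit a cover, and countably many covers merge into one
  through \<open>prod_decode\<close>.\<close>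

lemma ideal_E_cover:
  assumes "E \<in> ideal_E"
  obtains C :: "nat \<Rightarrow> cantor set"
  where "\<And>n. closed (C n)" "\<And>n. C n \<in> null_sets cantor_measure" "E \<subseteq> (\<Union>n. C n)"
proof -
  have "\<exists>C :: nat \<Rightarrow> cantor set.
      (\<forall>n. closed (C n) \<and> C n \<in> null_sets cantor_measure) \<and> E \<subseteq> (\<Union>n. C n)"
    using assms unfolding ideal_E_def
  proof (induction rule: generated_sigma_ideal.induct)
    case (base G)
    then show ?case by (intro exI[of _ "\<lambda>_. G"]) auto
  next
    case empty
    then show ?case by (intro exI[of _ "\<lambda>_. {}"]) auto
  next
    case (subset A B)
    then show ?case by (meson subset_trans)
  next
    case (Union A)
    then have "\<exists>C :: nat \<Rightarrow> nat \<Rightarrow> cantor set. \<forall>n.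
        (\<forall>m. closed (C n m) \<and> C n m \<in> null_sets cantor_measure) \<and> A n \<subseteq> (\<Union>m. C n m)"
      by (intro choice) blast
    then obtain C :: "nat \<Rightarrow> nat \<Rightarrow> cantor set" where
      C: "\<And>n m. closed (C n m)" "\<And>n m. C n m \<in> null_sets cantor_measure" "\<And>n. A n \<subseteq> (\<Union>m. C n m)"
      by blast
    let ?D = "\<lambda>k. case prod_decode k of (n, m) \<Rightarrow> C n m"
    have D: "C n m \<subseteq> (\<Union>k. ?D k)" for n m
      by (rule order_trans[OF _ UN_upper[of "prod_encode (n, m)"]]) auto
    have "(\<Union>n. A n) \<subseteq> (\<Union>k. ?D k)"
      by (intro UN_least order_trans[OF C(3)] D)
    then show ?case
      using C(1,2) by (intro exI[of _ ?D]) (auto split: prod.split)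
  qed
  then show ?thesis using that by blast
qed

lemma singleton_in_ideal_E: "{x} \<in> ideal_E"
  unfolding ideal_E_def
  by (intro generated_sigma_ideal.base) (simp add: closed_singleton_cantor singleton_null_cantor)

text \<open>By Baire category, a meager sum cannot be the whole space.\<close>

lemma E_into_M_subset_E_star: "E_into_M \<subseteq> E_star"
  using not_meager_UNIV by (auto simp: E_into_M_def E_star_def ideal_M_def)

text \<open>Ensures that both minima \<open>non\<close> in the theorem range over nonempty families.
  A single point, being closed and null, is a witness.\<close>

lemma UNIV_notin_E_star: "UNIV \<notin> E_star"
proof -
  have "sumset UNIV {x} = UNIV" for x
    by (auto simp: sumset_def) (metis cantor_add_cancel cantor_add_commute)
  then show ?thesis
    unfolding E_star_def using singleton_in_ideal_E by blast
qed

section \<open>The lower bound\<close>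

lemma nowhere_dense_Compl_Union_cylinders:
  "nowhere_dense (- (\<Union>q. cylinder (g q) (cantor_add z (finite_point q))))" (is "nowhere_dense (- ?U)")
proof -
  have "open ?U"
    by (intro open_UN ballI open_cylinder)
  then have "closure (- ?U) = - ?U"
    by (intro closure_closed closed_Compl)
  moreover have "interior (- ?U) = {}"
  proof (rule ccontr)
    assume "interior (- ?U) \<noteq> {}"
    then obtain y where "y \<in> interior (- ?U)" by blast
    then obtain k where k: "cylinder k y \<subseteq> interior (- ?U)"
      using open_contains_cylinder[OF open_interior] by blast
    \<comment> \<open>The target is \<open>z + y\<close> because adding \<open>z\<close> again leads
      back to \<open>y\<close>.\<close>
    obtain q where "finite_point q \<in> cylinder k (cantor_add z y)"
      using finite_point_dense by blast
    then have "cantor_add z (finite_point q) \<in> cylinder k y"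
      using cylinder_translation[of _ k "cantor_add z y" z] by simp
    moreover have "cantor_add z (finite_point q) \<in> ?U"
      by (blast intro: center_in_cylinder)
    ultimately show False
      using k interior_subset by blast
  qed
  ultimately show ?thesis
    by (simp add: nowhere_dense_def)
qed

lemma E_star_avoids_translates:
  assumes X: "X \<in> E_star"
    and C: "\<And>n::nat. closed (C n)" "\<And>n. C n \<in> null_sets cantor_measure"
  obtains z where
    "\<And>x q n. x \<in> X \<Longrightarrow> cantor_add z (finite_point q) \<notin> cantor_add x ` C n"
proof -
  let ?E = "\<Union>q n. cantor_add (finite_point q) ` C n"
  have translate: "cantor_add (finite_point q) ` C n \<in> generated_sigma_ideal
      {C. closed C \<and> C \<in> null_sets cantor_measure}" for q n
    by (intro generated_sigma_ideal.base) (simp add: closed_translation null_sets_translation C)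
  have "?E \<in> ideal_E"
    unfolding ideal_E_def by (intro generated_sigma_ideal.Union translate)
  then obtain z where z: "z \<notin> sumset X ?E"
    using X unfolding E_star_def by blast
  show ?thesis
  proof (rule that, rule notI)
    fix x q n
    assume x: "x \<in> X" and "cantor_add z (finite_point q) \<in> cantor_add x ` C n"
    then obtain c where c: "c \<in> C n" "cantor_add z (finite_point q) = cantor_add x c"
      by blast
    \<comment> \<open>Each point has order at most 2, so \<open>z + q = x + c\<close> gives
      \<open>z = x + (q + c)\<close> with \<open>q + c\<close> in \<open>?E\<close>.\<close>
    have "z = cantor_add (cantor_add z (finite_point q)) (finite_point q)"
      by (auto simp: cantor_add_def)
    also have "\<dots> = cantor_add x (cantor_add (finite_point q) c)"
      unfolding c(2) by (simp add: cantor_add_assoc cantor_add_commute[of c])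
    finally show False
      using z x c(1) unfolding sumset_def by blast
  qed
qed

text \<open>A common bound \<open>g\<close> replaces depths that vary with \<open>x\<close>, so the
  same nowhere dense sets \<open>N n\<close> serve all of \<open>X\<close>.\<close>

lemma bounded_imp_meager_sumset:
  assumes C: "mono C" "E \<subseteq> (\<Union>n. C n)"
    and depth: "\<And>x n q. x \<in> X \<Longrightarrow>
      cylinder (f x (prod_encode (n, q))) (cantor_add z (finite_point q)) \<inter> cantor_add x ` C n = {}"
    and g: "\<And>x. x \<in> X \<Longrightarrow> le_star (f x) g"
  shows "meager (sumset X E)"
proof -
  define N where
    "N n = - (\<Union>q. cylinder (g (prod_encode (n, q))) (cantor_add z (finite_point q)))" for n
  have "cantor_add x e \<in> (\<Union>n. N n)" if "x \<in> X" "e \<in> E" for x e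
  proof -
    obtain j where j: "e \<in> C j"
      using C(2) \<open>e \<in> E\<close> by blast
    obtain K where K: "\<And>m. m \<ge> K \<Longrightarrow> f x m \<le> g m"
      using g[OF \<open>x \<in> X\<close>] unfolding le_star_def eventually_sequentially by blast
    \<comment> \<open>\<open>j\<close> puts \<open>e\<close> into \<open>C n\<close>. Since
      \<open>prod_encode (n, q)\<close> is at least \<open>n\<close>, the threshold \<open>K\<close>
      is passed for all \<open>q\<close> at once.\<close>
    define n where "n = max j K"
    have "e \<in> C n"
      using j monoD[OF C(1), of j n] by (auto simp: n_def)
    have "cantor_add x e \<notin> cylinder (g (prod_encode (n, q))) (cantor_add z (finite_point q))" for q
    proof -
      have "K \<le> prod_encode (n, q)"
        using le_prod_encode_1[of n q] by (simp add: n_def)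
      then show ?thesis
        using depth[OF \<open>x \<in> X\<close>, of n q] \<open>e \<in> C n\<close> cylinder_antimono[OF K] by blast
    qed
    then show ?thesis
      by (auto simp: N_def)
  qed
  then have "sumset X E \<subseteq> (\<Union>n. N n)"
    unfolding sumset_def by blast
  moreover have "meager (\<Union>n. N n)"
    unfolding meager_def N_def
    by (rule exI, rule conjI, rule allI, rule nowhere_dense_Compl_Union_cylinders, rule refl)
  ultimately show ?thesis
    by (rule meager_subset[rotated])
qed

text \<open>The depth functions of the points of \<open>X\<close> form an unbounded family, since a
  bound would make \<open>sumset X E\<close> meager.\<close>

lemma bounding_number_le_of_E_star:
  assumes "X \<in> E_star" "X \<notin> E_into_M"
  shows "bounding_number \<le>o |X|"
proof -
  obtain E where E: "E \<in> ideal_E" "\<not> meager (sumset X E)"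
    using assms(2) unfolding E_into_M_def ideal_M_def by blast
  obtain D :: "nat \<Rightarrow> cantor set" where D: "\<And>n. closed (D n)" "\<And>n. D n \<in> null_sets cantor_measure" "E \<subseteq> (\<Union>n. D n)"
    using ideal_E_cover[OF E(1)] by blast
  \<comment> \<open>Finite unions stay closed and null, and monotonicity allows the index to be
    raised past any threshold.\<close>
  define C where "C n = (\<Union>i\<le>n. D i)" for n :: nat
  have C: "closed (C n)" "C n \<in> null_sets cantor_measure" for n
    unfolding C_def using D(1,2) by (auto intro: null_sets_UN')
  have "mono C"
    unfolding C_def by (intro monoI UN_mono) auto
  have cover: "E \<subseteq> (\<Union>n. C n)"
    using D(3) unfolding C_def by blast
  obtain z where z: "\<And>x q n. x \<in> X \<Longrightarrow> cantor_add z (finite_point q) \<notin> cantor_add x ` C n"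
    by (rule E_star_avoids_translates[of X C, OF assms(1) C]) blast
  define missing where "missing x n q k \<longleftrightarrow>
    cylinder k (cantor_add z (finite_point q)) \<inter> cantor_add x ` C n = {}" for x n q k
  have missing: "\<exists>k. missing x n q k" if "x \<in> X" for x n q
  proof -
    have "open (- cantor_add x ` C n)" "cantor_add z (finite_point q) \<in> - cantor_add x ` C n"
      using closed_translation[OF C(1)] z[OF that] by auto
    then obtain k where "cylinder k (cantor_add z (finite_point q)) \<subseteq> - cantor_add x ` C n"
      by (rule open_contains_cylinder)
    then show ?thesis
      unfolding missing_def by blast
  qed
  \<comment> \<open>Coding pairs by naturals turns the chosen depths into a function on the
    naturals.\<close>
  define f where "f x m = (case prod_decode m of (n, q) \<Rightarrow> SOME k. missing x n q k)" for x m
  have f: "missing x n q (f x (prod_encode (n, q)))" if "x \<in> X" for x n q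
    using someI_ex[OF missing[OF that]] by (simp add: f_def)
  have "\<not> (\<exists>g. \<forall>h\<in>f ` X. le_star h g)"
  proof
    assume "\<exists>g. \<forall>h\<in>f ` X. le_star h g"
    then obtain g where g: "\<And>x. x \<in> X \<Longrightarrow> le_star (f x) g"
      by blast
    have "meager (sumset X E)"
      by (rule bounded_imp_meager_sumset[OF \<open>mono C\<close> cover f[unfolded missing_def] g])
    with E(2) show False by contradiction
  qed
  then have "bounding_number \<le>o |f ` X|"
    unfolding bounding_number_def by (intro least_card_le) simp
  then show ?thesis
    using card_of_image ordLeq_transitive by blast
qed

section \<open>Comparing the cardinals\<close>

lemma Card_order_least_card: "Card_order (least_card \<A>)"
  unfolding least_card_def by (rule card_of_Card_order)

lemma card_min_le:
  assumes "Card_order r" "Card_order s" "r \<le>o t \<or> s \<le>o t"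
  shows "card_min r s \<le>o t"
proof (cases "r \<le>o s")
  case True
  then have "r \<le>o t"
    using assms(3) ordLeq_transitive by blast
  then show ?thesis
    by (rule ordIso_ordLeq_trans[OF card_min_eq_left[OF assms(1) True]])
next
  case False
  then have "s \<le>o r"
    using ordLeq_total[OF assms(1,2)[THEN card_order_on_well_order_on]] by blast
  then have "s \<le>o t"
    using assms(3) ordLeq_transitive by blast
  then show ?thesis
    by (rule ordIso_ordLeq_trans[OF card_min_eq_right[OF assms(1,2) \<open>s \<le>o r\<close>]])
qed

theorem proposition4p1:
  shows "card_min bounding_number (non E_star) \<le>o non E_into_M \<and> non E_into_M \<le>o non E_star"
proof
  have "{Y. Y \<notin> E_into_M} \<noteq> {}"
    using UNIV_notin_E_star E_into_M_subset_E_star by blast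
  then obtain X where X: "X \<notin> E_into_M" "non E_into_M = |X|"
    using least_card_attained[of "{Y. Y \<notin> E_into_M}"] unfolding non_def by blast
  \<comment> \<open>A smallest set outside \<open>E_into_M\<close> either lies in
    \<open>E_star\<close> and bounds \<open>bounding_number\<close>, or is itself a candidate for
    \<open>non E_star\<close>.\<close>
  have "bounding_number \<le>o |X| \<or> non E_star \<le>o |X|"
  proof (cases "X \<in> E_star")
    case True
    then show ?thesis
      using bounding_number_le_of_E_star[OF _ X(1)] by blast
  next
    case False
    then have "non E_star \<le>o |X|"
      unfolding non_def by (intro least_card_le) simp
    then show ?thesis ..
  qed
  then show "card_min bounding_number (non E_star) \<le>o non E_into_M"
    unfolding X(2) by (intro card_min_le) (simp_all add: bounding_number_def non_def Card_order_least_card)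
next
  obtain Y where Y: "Y \<notin> E_star" "non E_star = |Y|"
    using least_card_attained[of "{Y. Y \<notin> E_star}"] UNIV_notin_E_star unfolding non_def by blast
  then have "Y \<notin> E_into_M"
    using E_into_M_subset_E_star by blast
  then have "non E_into_M \<le>o |Y|"
    unfolding non_def by (intro least_card_le) simp
  then show "non E_into_M \<le>o non E_star"
    unfolding Y(2) .
qed

end
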